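(* Let $\Delta$ be a simplicial complex with (finite) vertex set $V$. Then $\Delta$ is a quasi-forest if and only if for every non-empty subset $W\subseteq V$, the induced subcomplex $\Delta_W$ has a leaf.
   Context: A simplicial complex $\Delta$ on a finite set $V$ is a collection of non-empty subsets of $V$ (faces) such that every non-empty subset of a face is a face. Its vertex set is $\{v : \{v\}\in\Delta\}$; "with vertex set $V$" means that $\{v\}\in\Delta$ for every $v\in V$. Facets are the maximal faces, and $\langle F_1,\dots,F_q\rangle$ denotes the complex whose facets are $F_1,\dots,F_q$. For $W\subseteq V$, the induced subcomplex is $\Delta_W=\{F\in\Delta : F\subseteq W\}$. A facet $F$ of $\Delta$ is a leaf if either $F$ is the only facet of $\Delta$, or there is a facet $G\neq F$ of $\Delta$ such that $F\cap H\subseteq G$ for all facets $H\neq F$ of $\Delta$. $\Delta$ is a quasi-forest if it has a leaf order, i.e. its facets can be ordered $F_1,\dots,F_q$ so that for each $i$, $F_i$ is a leaf of $\langle F_1,\dots,F_i\rangle$. *)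

theory Defs
  imports Main
begin

definition simplicial_complex :: "'a set \<Rightarrow> 'a set set \<Rightarrow> bool" where
  "simplicial_complex V \<Delta> \<longleftrightarrow>
     finite V \<and>
     (\<forall>F\<in>\<Delta>. F \<noteq> {} \<and> F \<subseteq> V) \<and>
     (\<forall>F\<in>\<Delta>. \<forall>G. G \<noteq> {} \<and> G \<subseteq> F \<longrightarrow> G \<in> \<Delta>)"

definition vertices :: "'a set set \<Rightarrow> 'a set" where
  "vertices \<Delta> = {v. {v} \<in> \<Delta>}"

definition facets :: "'a set set \<Rightarrow> 'a set set" where
  "facets \<Delta> = {F \<in> \<Delta>. \<forall>G\<in>\<Delta>. F \<subseteq> G \<longrightarrow> G = F}"

text \<open>The complex generated by a family of sets. It has exactly the given family as
  its facets when the family is an antichain of non-empty sets (lemma \<open>facets_generated\<close>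
  below); subfamilies of the facets of a complex always are.\<close>

definition generated_complex :: "'a set set \<Rightarrow> 'a set set" where
  "generated_complex \<F> = {G. G \<noteq> {} \<and> (\<exists>F\<in>\<F>. G \<subseteq> F)}"

definition induced_subcomplex :: "'a set set \<Rightarrow> 'a set \<Rightarrow> 'a set set" where
  "induced_subcomplex \<Delta> W = {F \<in> \<Delta>. F \<subseteq> W}"

definition leaf :: "'a set set \<Rightarrow> 'a set \<Rightarrow> bool" where
  "leaf \<Delta> F \<longleftrightarrow>
     F \<in> facets \<Delta> \<and>
     (facets \<Delta> = {F} \<or>
      (\<exists>G\<in>facets \<Delta>. G \<noteq> F \<and> (\<forall>H\<in>facets \<Delta>. H \<noteq> F \<longrightarrow> F \<inter> H \<subseteq> G)))"

text \<open>The facet at list position \<open>i\<close> (counted from 0) must be a leaf of the complex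
  generated by the facets at positions \<open>0, \<dots>, i\<close>. The empty complex has the empty
  list as a leaf order.\<close>

definition leaf_order :: "'a set set \<Rightarrow> 'a set list \<Rightarrow> bool" where
  "leaf_order \<Delta> Fs \<longleftrightarrow>
     distinct Fs \<and> set Fs = facets \<Delta> \<and>
     (\<forall>i<length Fs. leaf (generated_complex (set (take (Suc i) Fs))) (Fs ! i))"

definition quasi_forest :: "'a set set \<Rightarrow> bool" where
  "quasi_forest \<Delta> \<longleftrightarrow> (\<exists>Fs. leaf_order \<Delta> Fs)"

lemma facets_generated:
  assumes "{} \<notin> \<F>" and "\<And>F G. F \<in> \<F> \<Longrightarrow> G \<in> \<F> \<Longrightarrow> F \<subseteq> G \<Longrightarrow> F = G"
  shows "facets (generated_complex \<F>) = \<F>"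
proof (intro equalityI subsetI)
  fix F assume "F \<in> facets (generated_complex \<F>)"
  then have F: "F \<noteq> {}" "\<exists>G\<in>\<F>. F \<subseteq> G"
    and max: "\<And>G. G \<in> generated_complex \<F> \<Longrightarrow> F \<subseteq> G \<Longrightarrow> G = F"
    by (auto simp: facets_def generated_complex_def)
  from F(2) obtain G where G: "G \<in> \<F>" "F \<subseteq> G" by blast
  then have "G \<in> generated_complex \<F>"
    using assms(1) by (auto simp: generated_complex_def)
  with max G show "F \<in> \<F>" by blast
next
  fix F assume F: "F \<in> \<F>"
  then have "F \<in> generated_complex \<F>"
    using assms(1) by (auto simp: generated_complex_def)
  moreover have "G = F" if "G \<in> generated_complex \<F>" "F \<subseteq> G" for G
  proof -
    from that obtain H where H: "H \<in> \<F>" "G \<subseteq> H" by (auto simp: generated_complex_def)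
    with that F assms(2)[of F H] show ?thesis by blast
  qed
  ultimately show "F \<in> facets (generated_complex \<F>)" by (auto simp: facets_def)
qed

end

theory Submission
  imports Defs
begin

text \<open>
  A leaf order is a running intersection order: every facet after the first meets the union of
  its predecessors inside a single one of them. This property makes sense for arbitrary
  families of sets, not just for antichains, and in that generality it is inherited by the
  traces \<open>F \<inter> W\<close> on a set \<open>W\<close>. The facets of \<open>\<Delta>\<^sub>W\<close> are the maximal
  traces of facets of \<open>\<Delta>\<close>, so for the forward direction it is enough that the maximal members
  of a running intersection family always include a leaf (\<open>running_intersection_has_leaf\<close>).
  There, the last member \<open>A\<close> of the order is attached to some earlier \<open>B\<close>. If \<open>A\<close> and \<open>B\<close> are
  incomparable, \<open>A\<close> is a leaf, with any maximal member above \<open>B\<close> as the joint. If they are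
  comparable, the smaller one is redundant, and it can be removed without losing the running
  intersection property: either \<open>A\<close> is dropped or it takes over the position of \<open>B\<close>.

  For the converse, let \<open>F\<close> be a leaf of \<open>\<Delta>\<close>, not its only facet, with joint \<open>G\<close>, and let \<open>W\<close> be
  the union of the other facets. Since \<open>F \<inter> W \<subseteq> G\<close>, restricting to \<open>W\<close> removes \<open>F\<close> from the list
  of facets and leaves the others unchanged (\<open>facets_induced_remove_leaf\<close>), and \<open>W\<close> is a proper subset of the vertex set because
  \<open>F\<close> is not contained in \<open>G\<close>. By induction \<open>\<Delta>\<^sub>W\<close> has a leaf order, to which \<open>F\<close> is appended.

  The definitions of \<^const>\<open>facets\<close> and \<^const>\<open>leaf\<close> do not refer to closure under
  subsets; below they are applied to arbitrary families, where \<^const>\<open>facets\<close> gives the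
  maximal members.
\<close>

section \<open>Maximal members of a family of sets\<close>

lemma facetsD: "F \<in> facets \<F> \<Longrightarrow> F \<in> \<F>"
  by (simp add: facets_def)

lemma facets_cofinal:
  assumes "\<And>F. F \<in> \<A> \<Longrightarrow> \<exists>G\<in>\<B>. F \<subseteq> G" and "\<And>G. G \<in> \<B> \<Longrightarrow> \<exists>F\<in>\<A>. G \<subseteq> F"
  shows "facets \<A> = facets \<B>"
proof -
  have sub: "facets \<X> \<subseteq> facets \<Y>"
    if XY: "\<And>F. F \<in> \<X> \<Longrightarrow> \<exists>G\<in>\<Y>. F \<subseteq> G" and YX: "\<And>G. G \<in> \<Y> \<Longrightarrow> \<exists>F\<in>\<X>. G \<subseteq> F"
    for \<X> \<Y> :: "'a set set"
  proof
    fix F assume F: "F \<in> facets \<X>"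
    have eq: "G = F" if G: "G \<in> \<Y>" "F \<subseteq> G" for G
    proof -
      obtain F' where F': "F' \<in> \<X>" "G \<subseteq> F'" using YX[OF G(1)] by blast
      then have "F' = F" using F G(2) unfolding facets_def by blast
      then show ?thesis using F'(2) G(2) by blast
    qed
    moreover obtain G where "G \<in> \<Y>" "F \<subseteq> G"
      using XY[OF facetsD[OF F]] by blast
    ultimately have "F \<in> \<Y>" by metis
    with eq show "F \<in> facets \<Y>" unfolding facets_def by blast
  qed
  show ?thesis using sub[OF assms] sub[OF assms(2,1)] by (rule subset_antisym)
qed

lemma facets_above:
  assumes "finite \<F>" "A \<in> \<F>"
  shows "\<exists>M\<in>facets \<F>. A \<subseteq> M"
proof -
  obtain M where "M \<in> \<F>" "A \<subseteq> M" "\<forall>G\<in>\<F>. M \<subseteq> G \<longrightarrow> M = G"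
    using finite_has_maximal2[OF assms] by blast
  then show ?thesis by (auto simp: facets_def)
qed

lemma facets_of_subfamily:
  assumes "\<F> \<subseteq> facets \<Delta>"
  shows "facets \<F> = \<F>"
  using assms by (auto simp: facets_def)

lemma leaf_facets_cong:
  assumes "facets \<A> = facets \<B>"
  shows "leaf \<A> F \<longleftrightarrow> leaf \<B> F"
  using assms by (simp add: leaf_def)

section \<open>The running intersection property\<close>

text \<open>
  The families that can be ordered with the running intersection property, without recording
  an order. The condition \<open>A \<notin> \<F>\<close> makes every insertion increase the cardinality.
\<close>

inductive running_intersection :: "'a set set \<Rightarrow> bool" where
  single: "running_intersection {A}"
| attach: "\<lbrakk>running_intersection \<F>; A \<notin> \<F>; B \<in> \<F>; \<forall>C\<in>\<F>. A \<inter> C \<subseteq> B\<rbrakk>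
    \<Longrightarrow> running_intersection (insert A \<F>)"

lemma running_intersection_finite: "running_intersection \<F> \<Longrightarrow> finite \<F>"
  by (induction rule: running_intersection.induct) auto

text \<open>
  Only inclusions of the form \<open>C \<inter> D \<subseteq> E\<close> with \<open>C \<noteq> D\<close> enter the running intersection
  property, so a map that preserves these preserves the property. Taking traces on a set is
  such a map, and so is the exchange of one member in the comparable case of
  \<open>running_intersection_has_leaf\<close>.
\<close>

lemma running_intersection_image:
  assumes "running_intersection \<F>"
    and "\<And>C D E. \<lbrakk>C \<in> \<F>; D \<in> \<F>; E \<in> \<F>; C \<noteq> D; C \<inter> D \<subseteq> E\<rbrakk> \<Longrightarrow> f C \<inter> f D \<subseteq> f E"
  shows "running_intersection (f ` \<F>)"
  using assms
proof (induction rule: running_intersection.induct)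
  case (single A)
  then show ?case by (simp add: running_intersection.single)
next
  case (attach \<F> A B)
  have IH: "running_intersection (f ` \<F>)"
    using attach.IH attach.prems by blast
  show ?case
  proof (cases "f A \<in> f ` \<F>")
    case True
    with IH show ?thesis by (simp add: insert_absorb)
  next
    case False
    have "f A \<inter> f C \<subseteq> f B" if "C \<in> \<F>" for C
      using that attach.hyps by (intro attach.prems) auto
    with IH False \<open>B \<in> \<F>\<close> show ?thesis
      by (auto intro!: running_intersection.attach[where B = "f B"])
  qed
qed

text \<open>
  Induction on the number of members, since in the comparable cases the last member \<open>A\<close> is
  absorbed by a family that is smaller by at least one and has the same maximal members.
\<close>

lemma running_intersection_has_leaf:
  assumes "running_intersection \<F>"
  shows "\<exists>F. leaf \<F> F"
  using assms
proof (induction "card \<F>" arbitrary: \<F> rule: less_induct)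
  case less
  from less.prems show ?case
  proof cases
    case (single A)
    then have "leaf \<F> A" by (auto simp: leaf_def facets_def)
    then show ?thesis ..
  next
    case (attach \<F>' A B)
    have fin: "finite \<F>'" using attach running_intersection_finite by blast
    have card: "card \<F>' < card \<F>" using attach fin by simp
    consider "A \<subseteq> B" | "B \<subseteq> A" | "\<not> A \<subseteq> B" "\<not> B \<subseteq> A" by blast
    then show ?thesis
    proof cases
      case 1
      then have "facets \<F> = facets \<F>'"
        using attach by (intro facets_cofinal) auto
      with less.hyps[OF card] attach(2) leaf_facets_cong show ?thesis by metis
    next
      case 2
      define f where "f = (\<lambda>C. if C = B then A else C)"
      have "running_intersection (f ` \<F>')"
      proof (rule running_intersection_image)
        fix C D E assume "C \<in> \<F>'" "D \<in> \<F>'" "E \<in> \<F>'" "C \<noteq> D" "C \<inter> D \<subseteq> E"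
        \<comment> \<open>Away from \<open>B\<close>, the members meet \<open>A\<close> inside \<open>B\<close>, so the exchange does not
          enlarge any intersection of two distinct members.\<close>
        moreover have "E \<subseteq> f E" using 2 by (simp add: f_def)
        moreover have "f C \<inter> f D \<subseteq> C \<inter> D"
          using calculation attach by (auto simp: f_def)
        ultimately show "f C \<inter> f D \<subseteq> f E" by blast
      qed (use attach in simp)
      moreover have "card (f ` \<F>') < card \<F>"
        using card card_image_le[OF fin, of f] by linarith
      moreover have "facets \<F> = facets (f ` \<F>')"
        using attach 2 by (intro facets_cofinal) (auto simp: f_def)
      ultimately show ?thesis using less.hyps leaf_facets_cong by metis
    next
      case 3
      \<comment> \<open>A member of \<open>\<F>'\<close> above \<open>A\<close> would force \<open>A \<subseteq> B\<close>.\<close>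
      have "A \<in> facets \<F>" using attach 3 by (auto simp: facets_def)
      moreover obtain M where M: "M \<in> facets \<F>" "B \<subseteq> M"
        using facets_above[of \<F> B] attach fin by auto
      moreover have "M \<noteq> A" using M 3 by blast
      moreover have "A \<inter> H \<subseteq> M" if "H \<in> facets \<F>" "H \<noteq> A" for H
        using that attach M by (auto simp: facets_def)
      ultimately have "leaf \<F> A" unfolding leaf_def by blast
      then show ?thesis ..
    qed
  qed
qed

section \<open>Complexes and their facets\<close>

lemma simplicial_complex_face:
  assumes "simplicial_complex V \<Delta>" "F \<in> \<Delta>"
  shows "F \<noteq> {}" and "F \<subseteq> V" and "G \<noteq> {} \<Longrightarrow> G \<subseteq> F \<Longrightarrow> G \<in> \<Delta>"
  using assms unfolding simplicial_complex_def by blast+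

lemma simplicial_complex_finite:
  assumes "simplicial_complex V \<Delta>"
  shows "finite \<Delta>"
proof (rule finite_subset)
  show "\<Delta> \<subseteq> Pow V" using simplicial_complex_face(2)[OF assms] by blast
  show "finite (Pow V)" using assms by (simp add: simplicial_complex_def)
qed

lemma simplicial_complex_induced:
  assumes "simplicial_complex V \<Delta>" "W \<subseteq> V"
  shows "simplicial_complex W (induced_subcomplex \<Delta> W)"
proof -
  have "finite W" using assms finite_subset by (auto simp: simplicial_complex_def)
  then show ?thesis
    using assms unfolding simplicial_complex_def induced_subcomplex_def by blast
qed

lemma facets_generated_subfamily:
  assumes "simplicial_complex V \<Delta>" "\<F> \<subseteq> facets \<Delta>"
  shows "facets (generated_complex \<F>) = \<F>"
proof (rule facets_generated)
  show "{} \<notin> \<F>" using assms(2) simplicial_complex_face(1)[OF assms(1)] by (auto simp: facets_def)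
  show "F = G" if "F \<in> \<F>" "G \<in> \<F>" "F \<subseteq> G" for F G
    using that assms(2) unfolding facets_def by blast
qed

text \<open>
  The trace of a facet on \<open>W\<close> may be empty and thus no face. A vertex of the complex inside
  \<open>W\<close> guarantees that the empty trace is not maximal.
\<close>

lemma facets_induced_traces:
  assumes sc: "simplicial_complex V \<Delta>" and w: "w \<in> W" "{w} \<in> \<Delta>"
  shows "facets (induced_subcomplex \<Delta> W) = facets ((\<lambda>F. F \<inter> W) ` facets \<Delta>)"
proof (rule facets_cofinal)
  fix F assume "F \<in> induced_subcomplex \<Delta> W"
  then have F: "F \<in> \<Delta>" "F \<subseteq> W" by (simp_all add: induced_subcomplex_def)
  obtain M where M: "M \<in> facets \<Delta>" "F \<subseteq> M"
    using facets_above[OF simplicial_complex_finite[OF sc] F(1)] ..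
  have "F \<subseteq> M \<inter> W" using M(2) F(2) by (rule Int_greatest)
  then show "\<exists>G\<in>(\<lambda>F. F \<inter> W) ` facets \<Delta>. F \<subseteq> G"
    using imageI[OF M(1)] by (rule bexI)
next
  fix G assume "G \<in> (\<lambda>F. F \<inter> W) ` facets \<Delta>"
  then obtain F where F': "F \<in> facets \<Delta>" and G: "G = F \<inter> W" by blast
  have F: "F \<in> \<Delta>" by (rule facetsD[OF F'])
  show "\<exists>F\<in>induced_subcomplex \<Delta> W. G \<subseteq> F"
  proof (cases "G = {}")
    case True
    have "{w} \<in> induced_subcomplex \<Delta> W"
      using w by (simp add: induced_subcomplex_def)
    with True show ?thesis by (intro bexI) simp_all
  next
    case False
    then have "G \<in> \<Delta>" by (rule simplicial_complex_face(3)[OF sc F]) (simp add: G)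
    moreover have "G \<subseteq> W" by (simp add: G)
    ultimately have "G \<in> induced_subcomplex \<Delta> W"
      by (simp add: induced_subcomplex_def)
    then show ?thesis by (intro bexI[of _ G]) simp_all
  qed
qed

text \<open>
  Restricting to the union \<open>W\<close> of the other facets amounts to deleting the vertices that lie
  in \<open>F\<close> only. What is left of \<open>F\<close> is swallowed by its joint, and no other facet shrinks.
\<close>

lemma facets_induced_remove_leaf:
  assumes sc: "simplicial_complex V \<Delta>" and leaf: "leaf \<Delta> F" and ne: "facets \<Delta> \<noteq> {F}"
    and W: "W = \<Union>(facets \<Delta> - {F})"
  shows "facets (induced_subcomplex \<Delta> W) = facets \<Delta> - {F}" and "\<not> F \<subseteq> W"
proof -
  obtain G where G: "G \<in> facets \<Delta>" "G \<noteq> F"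
      and joint: "\<And>H. H \<in> facets \<Delta> \<Longrightarrow> H \<noteq> F \<Longrightarrow> F \<inter> H \<subseteq> G"
    using leaf ne by (auto simp: leaf_def)
  have FW: "F \<inter> W \<subseteq> G" using joint W by blast
  have "F \<in> facets \<Delta>" using leaf by (simp add: leaf_def)
  with G FW show "\<not> F \<subseteq> W" unfolding facets_def by blast
  have "facets (induced_subcomplex \<Delta> W) = facets (facets \<Delta> - {F})"
  proof (rule facets_cofinal)
    fix K assume "K \<in> induced_subcomplex \<Delta> W"
    then have K: "K \<in> \<Delta>" "K \<subseteq> W" by (auto simp: induced_subcomplex_def)
    then obtain H where "H \<in> facets \<Delta>" "K \<subseteq> H"
      using facets_above[OF simplicial_complex_finite[OF sc]] by blast
    then show "\<exists>H\<in>facets \<Delta> - {F}. K \<subseteq> H"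
      using K FW G by (cases "H = F") blast+
  next
    fix H assume "H \<in> facets \<Delta> - {F}"
    then show "\<exists>K\<in>induced_subcomplex \<Delta> W. H \<subseteq> K"
      using W unfolding induced_subcomplex_def by (blast dest: facetsD)
  qed
  also have "\<dots> = facets \<Delta> - {F}"
    by (rule facets_of_subfamily[of _ \<Delta>]) blast
  finally show "facets (induced_subcomplex \<Delta> W) = facets \<Delta> - {F}" .
qed

section \<open>Leaf orders\<close>

text \<open>
  An initial segment of a leaf order consists of pairwise incomparable sets, so it is exactly
  the set of facets of the complex that it generates. The joint of the \<open>i\<close>-th leaf is therefore
  one of its predecessors.
\<close>

lemma leaf_order_running_intersection:
  assumes sc: "simplicial_complex V \<Delta>" and order: "leaf_order \<Delta> Fs" and ne: "facets \<Delta> \<noteq> {}"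
  shows "running_intersection (facets \<Delta>)"
proof -
  from order have dist: "distinct Fs" and set: "set Fs = facets \<Delta>"
    and leaves: "\<And>i. i < length Fs \<Longrightarrow> leaf (generated_complex (set (take (Suc i) Fs))) (Fs ! i)"
    by (auto simp: leaf_order_def)
  have "running_intersection (set (take (Suc i) Fs))" if "i < length Fs" for i
    using that
  proof (induction i)
    case 0
    then show ?case by (simp add: take_Suc_conv_app_nth running_intersection.single)
  next
    case (Suc i)
    let ?\<F> = "set (take (Suc i) Fs)" and ?A = "Fs ! Suc i"
    have ins: "set (take (Suc (Suc i)) Fs) = insert ?A ?\<F>"
      using Suc.prems by (simp add: take_Suc_conv_app_nth[of "Suc i"])
    have A: "?A \<notin> ?\<F>"
      using Suc.prems dist by (auto simp: in_set_conv_nth nth_eq_iff_index_eq)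
    have "facets (generated_complex (insert ?A ?\<F>)) = insert ?A ?\<F>"
      using sc by (rule facets_generated_subfamily)
        (metis ins set set_take_subset)
    moreover have "Fs ! 0 \<in> ?\<F>" using Suc.prems by (cases Fs) auto
    then have "insert ?A ?\<F> \<noteq> {?A}" using A by auto
    ultimately obtain B where "B \<in> insert ?A ?\<F>" "B \<noteq> ?A"
        "\<forall>C\<in>insert ?A ?\<F>. C \<noteq> ?A \<longrightarrow> ?A \<inter> C \<subseteq> B"
      using leaves[OF Suc.prems] unfolding ins leaf_def by metis
    then have "B \<in> ?\<F>" "\<forall>C\<in>?\<F>. ?A \<inter> C \<subseteq> B" using A by auto
    then show ?case
      unfolding ins using Suc A by (intro running_intersection.attach) simp_all
  qed
  from this[of "length Fs - 1"] set ne show ?thesis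
    by (cases Fs) auto
qed

lemma quasi_forest_induced_has_leaf:
  assumes sc: "simplicial_complex V \<Delta>" and qf: "quasi_forest \<Delta>" and w: "w \<in> W" "{w} \<in> \<Delta>"
  shows "\<exists>F. leaf (induced_subcomplex \<Delta> W) F"
proof -
  have "facets \<Delta> \<noteq> {}"
    using facets_above[OF simplicial_complex_finite[OF sc] w(2)] by blast
  then have "running_intersection (facets \<Delta>)"
    using qf leaf_order_running_intersection[OF sc] by (auto simp: quasi_forest_def)
  then have "running_intersection ((\<lambda>F. F \<inter> W) ` facets \<Delta>)"
    by (rule running_intersection_image) blast
  then show ?thesis
    using running_intersection_has_leaf leaf_facets_cong[OF facets_induced_traces[OF sc w]]
    by blast
qed

lemma leaf_order_append:
  assumes sc: "simplicial_complex V \<Delta>" and order: "leaf_order \<Gamma> Fs"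
    and facets: "facets \<Gamma> = facets \<Delta> - {F}" and leaf: "leaf \<Delta> F"
  shows "leaf_order \<Delta> (Fs @ [F])"
proof -
  have F: "F \<in> facets \<Delta>" using leaf by (simp add: leaf_def)
  have set: "set Fs = facets \<Delta> - {F}" and dist: "distinct Fs"
    using order facets by (auto simp: leaf_order_def)
  have setF: "insert F (set Fs) = facets \<Delta>" using set F by blast
  have "facets (generated_complex (facets \<Delta>)) = facets \<Delta>"
    by (rule facets_generated_subfamily[OF sc order_refl])
  then have last: "leaf (generated_complex (facets \<Delta>)) F"
    using leaf leaf_facets_cong by metis
  have "leaf (generated_complex (set (take (Suc i) (Fs @ [F])))) ((Fs @ [F]) ! i)"
    if "i < length (Fs @ [F])" for i
  proof (cases "i < length Fs")
    case True
    then show ?thesis using order by (simp add: leaf_order_def nth_append)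
  next
    case False
    then have "i = length Fs" using that by simp
    then show ?thesis using last setF by simp
  qed
  then show ?thesis
    using set setF dist by (auto simp: leaf_order_def)
qed

lemma induced_leaves_quasi_forest:
  assumes "simplicial_complex V \<Delta>"
    and "\<And>W. W \<subseteq> V \<Longrightarrow> W \<noteq> {} \<Longrightarrow> \<exists>F. leaf (induced_subcomplex \<Delta> W) F"
  shows "quasi_forest \<Delta>"
proof -
  have "finite V" using assms(1) by (simp add: simplicial_complex_def)
  then show ?thesis
    using assms
  proof (induction V arbitrary: \<Delta> rule: finite_psubset_induct)
    case (psubset V)
    note sc = psubset.prems(1)
    note faces = simplicial_complex_face(1,2)[OF sc]
    have "\<exists>Fs. leaf_order \<Delta> Fs"
    proof (cases "V = {}")
      case True
      then have "\<Delta> = {}" using faces by blast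
      then have "leaf_order \<Delta> []" by (simp add: leaf_order_def facets_def)
      then show ?thesis ..
    next
      case False
      have "induced_subcomplex \<Delta> V = \<Delta>" using faces by (auto simp: induced_subcomplex_def)
      then obtain F where F: "leaf \<Delta> F" using psubset.prems(2)[OF order_refl False] by metis
      show ?thesis
      proof (cases "facets \<Delta> = {F}")
        case True
        have "leaf_order {} []" by (simp add: leaf_order_def facets_def)
        moreover have "facets {} = facets \<Delta> - {F}" using True by (simp add: facets_def)
        ultimately have "leaf_order \<Delta> ([] @ [F])" using F by (rule leaf_order_append[OF sc])
        then show ?thesis ..
      next
        case ne: False
        define W where "W = \<Union>(facets \<Delta> - {F})"
        note remove = facets_induced_remove_leaf[OF sc F ne W_def]
        have "F \<subseteq> V" using F faces(2) unfolding leaf_def by (blast dest: facetsD)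
        moreover have "W \<subseteq> V" using faces(2) unfolding W_def by (blast dest: facetsD)
        ultimately have WV: "W \<subset> V" using remove(2) by blast
        have "quasi_forest (induced_subcomplex \<Delta> W)"
        proof (rule psubset.IH[OF WV simplicial_complex_induced[OF sc]])
          show "W \<subseteq> V" using WV by blast
          fix U assume U: "U \<subseteq> W" "U \<noteq> {}"
          then have "induced_subcomplex (induced_subcomplex \<Delta> W) U = induced_subcomplex \<Delta> U"
            unfolding induced_subcomplex_def by blast
          moreover have "U \<subseteq> V" using U WV by blast
          ultimately show "\<exists>F. leaf (induced_subcomplex (induced_subcomplex \<Delta> W) U) F"
            using psubset.prems(2)[of U] U(2) by simp
        qed
        then obtain Fs where "leaf_order (induced_subcomplex \<Delta> W) Fs"
          unfolding quasi_forest_def ..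
        then have "leaf_order \<Delta> (Fs @ [F])" using remove(1) F by (rule leaf_order_append[OF sc])
        then show ?thesis ..
      qed
    qed
    then show ?case by (simp add: quasi_forest_def)
  qed
qed

theorem proposition6:
  fixes V :: "'a set" and \<Delta> :: "'a set set"
  assumes "simplicial_complex V \<Delta>"
    and "vertices \<Delta> = V"
  shows "quasi_forest \<Delta> \<longleftrightarrow>
    (\<forall>W. W \<subseteq> V \<and> W \<noteq> {} \<longrightarrow> (\<exists>F. leaf (induced_subcomplex \<Delta> W) F))"
proof
  assume qf: "quasi_forest \<Delta>"
  show "\<forall>W. W \<subseteq> V \<and> W \<noteq> {} \<longrightarrow> (\<exists>F. leaf (induced_subcomplex \<Delta> W) F)"
  proof (intro allI impI)
    fix W assume "W \<subseteq> V \<and> W \<noteq> {}"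
    then obtain w where "w \<in> W" "{w} \<in> \<Delta>" using assms(2) by (auto simp: vertices_def)
    then show "\<exists>F. leaf (induced_subcomplex \<Delta> W) F"
      by (rule quasi_forest_induced_has_leaf[OF assms(1) qf])
  qed
next
  assume "\<forall>W. W \<subseteq> V \<and> W \<noteq> {} \<longrightarrow> (\<exists>F. leaf (induced_subcomplex \<Delta> W) F)"
  then show "quasi_forest \<Delta>" using induced_leaves_quasi_forest[OF assms(1)] by blast
qed

end
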